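(* Let $\Gamma \cup \{\varphi\} \subseteq \mathfrak{F}_{\{\lor\}}$. Then $\Gamma \vdash_{\{\lor\}} \varphi$ if and only if $\Gamma \vDash_{\mathbf{2}} \varphi$.
   Context: Let $\Pi$ be an infinite set of propositional letters. $\mathfrak{F}_{\{\lor\}}$ is the set of formulas built from $\Pi$ using only the binary connective $\lor$. Derivability $\vdash_{\{\lor\}}$ is the smallest relation between sets of formulas of $\mathfrak{F}_{\{\lor\}}$ and formulas of $\mathfrak{F}_{\{\lor\}}$ satisfying: (R$_\in$) if $\varphi \in \Gamma$, then $\Gamma \vdash \varphi$; (R$_m$) if $\Gamma \vdash \varphi$, then $\Gamma, \psi \vdash \varphi$; (R$_t$) if $\Gamma \vdash \varphi$ and $\Delta, \varphi \vdash \psi$, then $\Gamma, \Delta \vdash \psi$; (R$_\lor$) $\Gamma, \varphi \lor \psi \vdash \chi$ iff $\Gamma, \varphi \vdash \chi$ and $\Gamma, \psi \vdash \chi$. $\mathbf{2}$ is the algebra $\langle \{0,1\}; \lor\rangle$ where $\lor$ is the join (maximum) for the order $0<1$, with set of designated values $D=\{1\}$. $\Gamma \vDash_{\mathbf{2}} \varphi$ means: for every assignment $v : \Pi \to \{0,1\}$, with unique homomorphic extension $\bar v : \mathfrak{F}_{\{\lor\}} \to \{0,1\}$, if $\bar v(\psi) = 1$ for all $\psi \in \Gamma$, then $\bar v(\varphi) = 1$. *)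

theory Defs
  imports Main
begin

datatype 'p form =
    Letter 'p
  | Or "'p form" "'p form"  (infixr \<open>\<^bold>\<or>\<close> 60)

text \<open>
  The biconditional rule for disjunction is split into one rule (\<open>OrI\<close>) for its right-to-left
  direction and two rules (\<open>OrD1\<close>, \<open>OrD2\<close>) for its left-to-right direction.
  Contexts are arbitrary, possibly infinite, sets of formulas.
\<close>

inductive derives :: "'p form set \<Rightarrow> 'p form \<Rightarrow> bool"  (infix \<open>\<turnstile>\<close> 50) where
  In: "\<phi> \<in> \<Gamma> \<Longrightarrow> \<Gamma> \<turnstile> \<phi>"
| Mono: "\<Gamma> \<turnstile> \<phi> \<Longrightarrow> insert \<psi> \<Gamma> \<turnstile> \<phi>"
| Trans: "\<Gamma> \<turnstile> \<phi> \<Longrightarrow> insert \<phi> \<Delta> \<turnstile> \<psi> \<Longrightarrow> \<Gamma> \<union> \<Delta> \<turnstile> \<psi>"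
| OrI: "insert \<phi> \<Gamma> \<turnstile> \<chi> \<Longrightarrow> insert \<psi> \<Gamma> \<turnstile> \<chi> \<Longrightarrow> insert (\<phi> \<^bold>\<or> \<psi>) \<Gamma> \<turnstile> \<chi>"
| OrD1: "insert (\<phi> \<^bold>\<or> \<psi>) \<Gamma> \<turnstile> \<chi> \<Longrightarrow> insert \<phi> \<Gamma> \<turnstile> \<chi>"
| OrD2: "insert (\<phi> \<^bold>\<or> \<psi>) \<Gamma> \<turnstile> \<chi> \<Longrightarrow> insert \<psi> \<Gamma> \<turnstile> \<chi>"

definition closed_under_rules :: "('p form set \<Rightarrow> 'p form \<Rightarrow> bool) \<Rightarrow> bool" where
  "closed_under_rules R \<longleftrightarrow>
     (\<forall>\<Gamma> \<phi>. \<phi> \<in> \<Gamma> \<longrightarrow> R \<Gamma> \<phi>) \<and>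
     (\<forall>\<Gamma> \<phi> \<psi>. R \<Gamma> \<phi> \<longrightarrow> R (insert \<psi> \<Gamma>) \<phi>) \<and>
     (\<forall>\<Gamma> \<Delta> \<phi> \<psi>. R \<Gamma> \<phi> \<and> R (insert \<phi> \<Delta>) \<psi> \<longrightarrow> R (\<Gamma> \<union> \<Delta>) \<psi>) \<and>
     (\<forall>\<Gamma> \<phi> \<psi> \<chi>. R (insert (\<phi> \<^bold>\<or> \<psi>) \<Gamma>) \<chi> \<longleftrightarrow> R (insert \<phi> \<Gamma>) \<chi> \<and> R (insert \<psi> \<Gamma>) \<chi>)"

lemma closed_under_rules_derives: "closed_under_rules (\<turnstile>)"
  unfolding closed_under_rules_def by (blast intro: derives.intros)

lemma derives_least:
  assumes "closed_under_rules R" and "\<Gamma> \<turnstile> \<phi>"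
  shows "R \<Gamma> \<phi>"
  using assms(2)
  by induction (use assms(1) in \<open>unfold closed_under_rules_def, blast+\<close>)

text \<open>
  The two-element join-semilattice is \<^typ>\<open>bool\<close> with \<^const>\<open>sup\<close>, where
  \<^term>\<open>False\<close> and \<^term>\<open>True\<close> play the roles of 0 and 1; on \<^typ>\<open>bool\<close> the library
  order is \<^prop>\<open>False < True\<close> and \<^const>\<open>sup\<close> is its join.
\<close>

primrec hom_ext :: "('p \<Rightarrow> bool) \<Rightarrow> 'p form \<Rightarrow> bool" where
  "hom_ext v (Letter p) = v p"
| "hom_ext v (\<phi> \<^bold>\<or> \<psi>) = sup (hom_ext v \<phi>) (hom_ext v \<psi>)"

lemma hom_ext_unique:
  assumes "\<And>p. h (Letter p) = v p" and "\<And>\<phi> \<psi>. h (\<phi> \<^bold>\<or> \<psi>) = sup (h \<phi>) (h \<psi>)"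
  shows "h = hom_ext v"
proof
  show "h \<phi> = hom_ext v \<phi>" for \<phi>
    by (induction \<phi>) (simp_all only: assms hom_ext.simps)
qed

definition designated :: "bool set" where
  "designated = {True}"

definition entails2 :: "'p form set \<Rightarrow> 'p form \<Rightarrow> bool"  (infix \<open>\<Turnstile>\<^sub>2\<close> 50) where
  "\<Gamma> \<Turnstile>\<^sub>2 \<phi> \<longleftrightarrow>
     (\<forall>v. (\<forall>\<psi>\<in>\<Gamma>. hom_ext v \<psi> \<in> designated) \<longrightarrow> hom_ext v \<phi> \<in> designated)"

end

theory Submission
  imports Defs
begin

text \<open>
  A formula here is a nonempty disjunction of its letters, so a valuation refutes it exactly when it
  refutes all of its letters. For completeness, let \<open>\<Gamma> \<Turnstile>\<^sub>2 \<phi>\<close> and take the largest valuation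
  refuting \<open>\<phi>\<close>, the one that is false exactly on the letters of \<open>\<phi>\<close>. It must refute some
  premise \<open>\<psi>\<close>, which means that every letter of \<open>\<psi>\<close> occurs in \<open>\<phi>\<close>. In that case
  \<open>\<psi>\<close> alone already derives \<open>\<phi>\<close>: each letter of \<open>\<phi>\<close> derives \<open>\<phi>\<close>
  (\<open>derives_from_letter\<close>, the elimination direction of the rule for disjunction), and
  whatever follows from each letter of \<open>\<psi>\<close> follows from \<open>\<psi>\<close>
  (\<open>derives_by_letter_cases\<close>, the introduction direction).
\<close>

lemma hom_ext_iff_letter: "hom_ext v \<phi> \<longleftrightarrow> (\<exists>p\<in>set_form \<phi>. v p)"
  by (induction \<phi>) auto

lemma derives_sound:
  assumes "\<Gamma> \<turnstile> \<phi>"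
  shows "\<Gamma> \<Turnstile>\<^sub>2 \<phi>"
  using assms by induction (auto simp: entails2_def designated_def)

text \<open>
  The induction follows the path in \<open>\<phi>\<close> down to an occurrence of the letter, replacing the
  premise by one of its disjuncts at each step. The conclusion \<open>\<chi>\<close> has to be kept apart from
  \<open>\<phi>\<close>, since it stays the same while the premise shrinks.
\<close>
lemma derives_from_letter:
  assumes "insert \<phi> \<Gamma> \<turnstile> \<chi>" and "p \<in> set_form \<phi>"
  shows "insert (Letter p) \<Gamma> \<turnstile> \<chi>"
  using assms by (induction \<phi>) (auto dest: OrD1 OrD2)

lemma derives_by_letter_cases:
  assumes "\<And>p. p \<in> set_form \<psi> \<Longrightarrow> insert (Letter p) \<Gamma> \<turnstile> \<chi>"
  shows "insert \<psi> \<Gamma> \<turnstile> \<chi>"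
  using assms by (induction \<psi>) (auto intro: OrI)

text \<open>
  A valuation refuting \<open>\<phi>\<close> must refute some premise; making it true on every letter outside
  \<open>\<phi>\<close> leaves only premises with all letters in \<open>\<phi>\<close> as candidates.
\<close>
lemma entails2_premise_letters_subset:
  assumes "\<Gamma> \<Turnstile>\<^sub>2 \<phi>"
  obtains \<psi> where "\<psi> \<in> \<Gamma>" and "set_form \<psi> \<subseteq> set_form \<phi>"
proof -
  have "\<not> hom_ext (\<lambda>p. p \<notin> set_form \<phi>) \<phi>"
    by (simp add: hom_ext_iff_letter)
  with assms obtain \<psi> where "\<psi> \<in> \<Gamma>" and "\<not> hom_ext (\<lambda>p. p \<notin> set_form \<phi>) \<psi>"
    by (auto simp: entails2_def designated_def)
  then show thesis
    by (intro that) (auto simp: hom_ext_iff_letter)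
qed

lemma entails2_complete:
  assumes "\<Gamma> \<Turnstile>\<^sub>2 \<phi>"
  shows "\<Gamma> \<turnstile> \<phi>"
proof -
  obtain \<psi> where "\<psi> \<in> \<Gamma>" and sub: "set_form \<psi> \<subseteq> set_form \<phi>"
    using assms by (rule entails2_premise_letters_subset)
  have "insert \<psi> \<Gamma> \<turnstile> \<phi>"
  proof (rule derives_by_letter_cases)
    fix p assume "p \<in> set_form \<psi>"
    moreover have "insert \<phi> \<Gamma> \<turnstile> \<phi>"
      by (simp add: In)
    ultimately show "insert (Letter p) \<Gamma> \<turnstile> \<phi>"
      using sub by (blast intro: derives_from_letter)
  qed
  with \<open>\<psi> \<in> \<Gamma>\<close> show ?thesis
    by (simp add: insert_absorb)
qed

theorem corollary2:
  fixes \<Gamma> :: "'p form set" and \<phi> :: "'p form"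
  assumes "infinite (UNIV :: 'p set)"
  shows "\<Gamma> \<turnstile> \<phi> \<longleftrightarrow> \<Gamma> \<Turnstile>\<^sub>2 \<phi>"
  using derives_sound entails2_complete by blast

end
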